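(* Let $G$ be a finite simple graph with vertices $v_1,\ldots,v_n$, $L$ a list of $G$ and $w$ a weight of $G$. Then a vector $\vec w^*\in\mathbb N^n$ is a solution to the on call problem for $(G,L,w)$ if and only if $\vec w^*\in\min(\vec w,\overrightarrow{W}_{max}(G,L))$ and $\|\vec w^*\|\ge\|\vec w'\|$ for every $\vec w'\in\min(\vec w,\overrightarrow{W}_{max}(G,L))$.
   Context: A list of $G$ assigns to each vertex $v$ a finite set $L(v)\subset\mathbb N$; $\overline L=\bigcup_v L(v)$. A weight is a map $w:V(G)\to\mathbb N$ with weight-vector $\vec w=\sum_i w(v_i)\vec e_i$. An $(L,w)$-coloring is a map $C$ with $C(v)\subset L(v)$, $|C(v)|=w(v)$ and $C(v)\cap C(v')=\emptyset$ for every edge $vv'$. $\overrightarrow{W}(G,L)$ is the set of $\vec w\in\mathbb N^n$ such that $G$ is $(L,w)$-colorable. For $\vec x\in\mathbb N^n$, $\|\vec x\|=\sum_i x_i$; $\vec y\le\vec x$ means coordinatewise inequality; $\min(\vec x,\vec y)$ is the coordinatewise minimum. A solution to the on call problem for $(G,L,w)$ is a vector $\vec w^*\in\overrightarrow{W}(G,L)$ with $\vec w^*\le\vec w$ such that $\|\vec w-\vec w^*\|$ is minimal among all such vectors. For $N\subset V(G)$, $\vec N=\sum_i\lambda_i\vec e_i$ with $\lambda_i=1$ if $v_i\in N$, else $0$. For a color $x$, $G^x$ is the subgraph induced by the vertices $v$ with $x\in L(v)$; $\overrightarrow{MIS}(H)=\{\vec N: N$ a maximal (w.r.t. inclusion)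 independent set of $H\}$; $\overrightarrow{W}_{max}(G,L)=\sum_{x\in\overline L}\overrightarrow{MIS}(G^x)$ (vectorial sum of sets). Finally $\min(\vec w,\overrightarrow{W}_{max}(G,L))=\{\min(\vec w,\vec w'):\vec w'\in\overrightarrow{W}_{max}(G,L)\}$. *)

theory Defs
  imports
    "Graph_Theory.Digraph_Component"
    "HOL-Library.Function_Algebras"
    "HOL-Library.Set_Algebras"
begin

text \<open>
  A finite simple graph is a finite, loop-free, symmetric digraph without parallel arcs (locale
  \<open>graph\<close> of \<open>Graph_Theory\<close>); every undirected edge is a pair of opposite arcs.

  The vertices are enumerated as \<open>v 1, \<dots>, v n\<close> by a function \<open>v :: nat \<Rightarrow> 'a\<close>. Vectors with
  \<open>n\<close> natural-number entries are functions \<open>nat \<Rightarrow> nat\<close> vanishing outside \<open>{1..n}\<close>,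
  so that the pointwise \<open>+\<close>, \<open>-\<close> and \<open>\<le>\<close> of the library are the coordinatewise ones, and
  \<open>+\<close> and \<open>\<Sum>\<close> on sets of vectors are the elementwise (Minkowski) sums of \<open>Set_Algebras\<close>.
\<close>

definition nat_vecs :: "nat \<Rightarrow> (nat \<Rightarrow> nat) set" where
  "nat_vecs n = {x. \<forall>i. i \<notin> {1..n} \<longrightarrow> x i = 0}"

definition vec_norm :: "nat \<Rightarrow> (nat \<Rightarrow> nat) \<Rightarrow> nat" where
  "vec_norm n x = (\<Sum>i = 1..n. x i)"

definition vec_min :: "(nat \<Rightarrow> nat) \<Rightarrow> (nat \<Rightarrow> nat) \<Rightarrow> (nat \<Rightarrow> nat)" where
  "vec_min x y = (\<lambda>i. min (x i) (y i))"

definition weight_vec :: "nat \<Rightarrow> (nat \<Rightarrow> 'a) \<Rightarrow> ('a \<Rightarrow> nat) \<Rightarrow> (nat \<Rightarrow> nat)" where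
  "weight_vec n v w = (\<lambda>i. if i \<in> {1..n} then w (v i) else 0)"

definition set_vec :: "nat \<Rightarrow> (nat \<Rightarrow> 'a) \<Rightarrow> 'a set \<Rightarrow> (nat \<Rightarrow> nat)" where
  "set_vec n v N = (\<lambda>i. if i \<in> {1..n} \<and> v i \<in> N then 1 else 0)"

definition list_of_graph :: "('a, 'b) pre_digraph \<Rightarrow> ('a \<Rightarrow> nat set) \<Rightarrow> bool" where
  "list_of_graph G L \<longleftrightarrow> (\<forall>u \<in> verts G. finite (L u))"

definition all_colors :: "('a, 'b) pre_digraph \<Rightarrow> ('a \<Rightarrow> nat set) \<Rightarrow> nat set" where
  "all_colors G L = (\<Union>u \<in> verts G. L u)"

definition is_coloring ::
  "('a, 'b) pre_digraph \<Rightarrow> ('a \<Rightarrow> nat set) \<Rightarrow> ('a \<Rightarrow> nat) \<Rightarrow> ('a \<Rightarrow> nat set) \<Rightarrow> bool" where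
  "is_coloring G L w C \<longleftrightarrow>
     (\<forall>u \<in> verts G. C u \<subseteq> L u \<and> card (C u) = w u) \<and>
     (\<forall>u u'. u \<rightarrow>\<^bsub>G\<^esub> u' \<longrightarrow> C u \<inter> C u' = {})"

definition colorable ::
  "('a, 'b) pre_digraph \<Rightarrow> ('a \<Rightarrow> nat set) \<Rightarrow> ('a \<Rightarrow> nat) \<Rightarrow> bool" where
  "colorable G L w \<longleftrightarrow> (\<exists>C. is_coloring G L w C)"

definition W_set ::
  "('a, 'b) pre_digraph \<Rightarrow> nat \<Rightarrow> (nat \<Rightarrow> 'a) \<Rightarrow> ('a \<Rightarrow> nat set) \<Rightarrow> (nat \<Rightarrow> nat) set" where
  "W_set G n v L = {weight_vec n v w | w. colorable G L w}"

text \<open>The truncated subtraction is harmless: it is only applied to vectors below the weight-vector.\<close>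

definition on_call_solution ::
  "('a, 'b) pre_digraph \<Rightarrow> nat \<Rightarrow> (nat \<Rightarrow> 'a) \<Rightarrow> ('a \<Rightarrow> nat set) \<Rightarrow> ('a \<Rightarrow> nat) \<Rightarrow> (nat \<Rightarrow> nat) \<Rightarrow> bool" where
  "on_call_solution G n v L w x \<longleftrightarrow>
     x \<in> W_set G n v L \<and> x \<le> weight_vec n v w \<and>
     (\<forall>y \<in> W_set G n v L. y \<le> weight_vec n v w \<longrightarrow>
        vec_norm n (weight_vec n v w - x) \<le> vec_norm n (weight_vec n v w - y))"

definition color_subgraph ::
  "('a, 'b) pre_digraph \<Rightarrow> ('a \<Rightarrow> nat set) \<Rightarrow> nat \<Rightarrow> ('a, 'b) pre_digraph" where
  "color_subgraph G L c = G \<restriction> {u \<in> verts G. c \<in> L u}"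

definition independent_set :: "('a, 'b) pre_digraph \<Rightarrow> 'a set \<Rightarrow> bool" where
  "independent_set H N \<longleftrightarrow> N \<subseteq> verts H \<and> (\<forall>u \<in> N. \<forall>u' \<in> N. \<not> u \<rightarrow>\<^bsub>H\<^esub> u')"

definition maximal_independent_set :: "('a, 'b) pre_digraph \<Rightarrow> 'a set \<Rightarrow> bool" where
  "maximal_independent_set H N \<longleftrightarrow>
     independent_set H N \<and> (\<forall>M. independent_set H M \<and> N \<subseteq> M \<longrightarrow> M = N)"

definition MIS_vecs :: "nat \<Rightarrow> (nat \<Rightarrow> 'a) \<Rightarrow> ('a, 'b) pre_digraph \<Rightarrow> (nat \<Rightarrow> nat) set" where
  "MIS_vecs n v H = {set_vec n v N | N. maximal_independent_set H N}"

definition W_max ::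
  "('a, 'b) pre_digraph \<Rightarrow> nat \<Rightarrow> (nat \<Rightarrow> 'a) \<Rightarrow> ('a \<Rightarrow> nat set) \<Rightarrow> (nat \<Rightarrow> nat) set" where
  "W_max G n v L = (\<Sum>c \<in> all_colors G L. MIS_vecs n v (color_subgraph G L c))"

definition min_set :: "(nat \<Rightarrow> nat) \<Rightarrow> (nat \<Rightarrow> nat) set \<Rightarrow> (nat \<Rightarrow> nat) set" where
  "min_set x A = {vec_min x y | y. y \<in> A}"

end

theory Submission
  imports Defs
begin

text \<open>
  The vectors in \<open>W_max\<close> are weight-vectors of colorings, every weight-vector of a coloring lies
  below one of them (extend each color class to a maximal independent set of its color subgraph),
  and the colorable weight-vectors are closed downwards. So an optimal vector \<open>x\<close> lies below some
  \<open>min(w, y)\<close> with \<open>y\<close> in \<open>W_max\<close>, which is itself feasible; optimality makes the norms equal,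
  and then the vectors coincide.
\<close>

lemma dominates_color_subgraph_iff:
  "u \<rightarrow>\<^bsub>color_subgraph G L c\<^esub> u' \<longleftrightarrow>
    u \<rightarrow>\<^bsub>G\<^esub> u' \<and> u \<in> verts G \<and> c \<in> L u \<and> u' \<in> verts G \<and> c \<in> L u'"
  by (auto simp: color_subgraph_def arcs_ends_def arc_to_ends_def induce_subgraph_def)

lemma independent_set_color_subgraph_iff:
  "independent_set (color_subgraph G L c) N \<longleftrightarrow>
    N \<subseteq> {u \<in> verts G. c \<in> L u} \<and> (\<forall>u \<in> N. \<forall>u' \<in> N. \<not> u \<rightarrow>\<^bsub>G\<^esub> u')"
proof -
  have "verts (color_subgraph G L c) = {u \<in> verts G. c \<in> L u}"
    by (simp add: color_subgraph_def)
  then show ?thesis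
    unfolding independent_set_def dominates_color_subgraph_iff by blast
qed

text \<open>A finite graph has only finitely many independent sets, so among those containing
  \<open>N\<close> one is maximal for inclusion.\<close>

lemma independent_set_extends_to_maximal:
  assumes "finite (verts H)" "independent_set H N"
  obtains M where "maximal_independent_set H M" "N \<subseteq> M"
proof -
  let ?F = "{M. independent_set H M}"
  have "?F \<subseteq> Pow (verts H)"
    by (auto simp: independent_set_def)
  then have "finite ?F"
    using assms(1) by (meson finite_Pow_iff finite_subset)
  then obtain M where "M \<in> ?F" "N \<subseteq> M" "\<forall>M' \<in> ?F. M \<subseteq> M' \<longrightarrow> M = M'"
    using finite_has_maximal2[of ?F N] assms(2) by auto
  then show thesis
    by (intro that[of M]) (auto simp: maximal_independent_set_def)
qed

lemma finite_all_colors: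
  assumes "finite (verts G)" "list_of_graph G L"
  shows "finite (all_colors G L)"
  using assms by (simp add: all_colors_def list_of_graph_def)

text \<open>Coordinate \<open>i\<close> of the sum counts the \<open>c\<close> with
  \<open>v i \<in> N c\<close>. This passes from color classes \<open>N c\<close> to the set of
  colors received by each vertex.\<close>

lemma sum_set_vec:
  assumes "finite A"
  shows "(\<Sum>c\<in>A. set_vec n v (N c)) = weight_vec n v (\<lambda>u. card {c \<in> A. u \<in> N c})"
proof
  fix i
  have "(\<Sum>c\<in>A. set_vec n v (N c)) i = (\<Sum>c\<in>A. set_vec n v (N c) i)"
    using assms by (induction A rule: finite_induct) auto
  also have "\<dots> = weight_vec n v (\<lambda>u. card {c \<in> A. u \<in> N c}) i"
    using assms by (cases "i \<in> {1..n}") (auto simp: set_vec_def weight_vec_def sum.If_cases Int_def)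
  finally show "(\<Sum>c\<in>A. set_vec n v (N c)) i = weight_vec n v (\<lambda>u. card {c \<in> A. u \<in> N c}) i" .
qed

text \<open>An element of the Minkowski sum amounts to a choice of one maximal independent set
  \<open>N c\<close> per color, and \<open>sum_set_vec\<close> evaluates the resulting sum.\<close>

lemma W_max_eq:
  assumes "finite (verts G)" "list_of_graph G L"
  shows "W_max G n v L =
    {weight_vec n v (\<lambda>u. card {c \<in> all_colors G L. u \<in> N c}) | N.
      \<forall>c \<in> all_colors G L. maximal_independent_set (color_subgraph G L c) (N c)}" (is "_ = ?R")
proof -
  let ?A = "all_colors G L"
  have fin: "finite ?A"
    using assms by (rule finite_all_colors)
  have eq: "W_max G n v L =
      {\<Sum>c\<in>?A. s c | s. \<forall>c\<in>?A. s c \<in> MIS_vecs n v (color_subgraph G L c)}"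
    unfolding W_max_def by (rule set_sum_alt[OF fin])
  show ?thesis
  proof (intro equalityI subsetI)
    fix x assume "x \<in> W_max G n v L"
    then obtain s where x: "x = sum s ?A"
      and s: "\<forall>c\<in>?A. \<exists>N. s c = set_vec n v N \<and> maximal_independent_set (color_subgraph G L c) N"
      unfolding eq MIS_vecs_def by blast
    from bchoice[OF s] obtain N where
      N: "\<forall>c\<in>?A. s c = set_vec n v (N c) \<and> maximal_independent_set (color_subgraph G L c) (N c)"
      by blast
    then have "x = (\<Sum>c\<in>?A. set_vec n v (N c))"
      unfolding x by (intro sum.cong) auto
    then show "x \<in> ?R"
      using N sum_set_vec[OF fin] by blast
  next
    fix x assume "x \<in> ?R"
    then obtain N where "x = (\<Sum>c\<in>?A. set_vec n v (N c))"
      and "\<forall>c\<in>?A. maximal_independent_set (color_subgraph G L c) (N c)"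
      unfolding sum_set_vec[OF fin] by blast
    then show "x \<in> W_max G n v L"
      unfolding eq MIS_vecs_def by blast
  qed
qed

text \<open>Give \<open>u\<close> all colors \<open>c\<close> with \<open>u \<in> N c\<close>: since
  \<open>N c\<close> lies in the color subgraph, \<open>c\<close> is in \<open>L u\<close>, and
  independence keeps adjacent vertices disjoint.\<close>

lemma W_max_subset_W_set:
  assumes "finite (verts G)" "list_of_graph G L"
  shows "W_max G n v L \<subseteq> W_set G n v L"
proof
  let ?A = "all_colors G L"
  fix x assume "x \<in> W_max G n v L"
  then obtain N where x: "x = weight_vec n v (\<lambda>u. card {c \<in> ?A. u \<in> N c})"
    and "\<forall>c\<in>?A. maximal_independent_set (color_subgraph G L c) (N c)"
    unfolding W_max_eq[OF assms] by blast
  then have "\<forall>c\<in>?A. N c \<subseteq> {u \<in> verts G. c \<in> L u} \<and> (\<forall>u\<in>N c. \<forall>u'\<in>N c. \<not> u \<rightarrow>\<^bsub>G\<^esub> u')"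
    by (simp add: maximal_independent_set_def independent_set_color_subgraph_iff)
  then have "is_coloring G L (\<lambda>u. card {c \<in> ?A. u \<in> N c}) (\<lambda>u. {c \<in> ?A. u \<in> N c})"
    unfolding is_coloring_def by blast
  then show "x \<in> W_set G n v L"
    unfolding x W_set_def colorable_def by blast
qed

lemma W_set_below_W_max:
  assumes "finite (verts G)" "list_of_graph G L" "bij_betw v {1..n} (verts G)"
    and "x \<in> W_set G n v L"
  obtains y where "y \<in> W_max G n v L" "x \<le> y"
proof -
  let ?A = "all_colors G L"
  obtain w C where x: "x = weight_vec n v w" and C: "is_coloring G L w C"
    using assms(4) unfolding W_set_def colorable_def by blast
  \<comment> \<open>Stated for every natural number \<open>c\<close>: for a \<open>c\<close> in no
    list the color subgraph has no vertices and \<open>M\<close> is empty, so \<open>N\<close> can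
    be chosen unconditionally.\<close>
  have "\<exists>M. maximal_independent_set (color_subgraph G L c) M \<and> {u \<in> verts G. c \<in> C u} \<subseteq> M" for c
  proof -
    have "finite (verts (color_subgraph G L c))"
      using assms(1) by (simp add: color_subgraph_def)
    moreover have "independent_set (color_subgraph G L c) {u \<in> verts G. c \<in> C u}"
      using C unfolding independent_set_color_subgraph_iff is_coloring_def by blast
    ultimately show ?thesis
      by (meson independent_set_extends_to_maximal)
  qed
  then obtain N where N: "\<And>c. maximal_independent_set (color_subgraph G L c) (N c)"
    and sub: "\<And>c. {u \<in> verts G. c \<in> C u} \<subseteq> N c"
    by metis
  let ?y = "weight_vec n v (\<lambda>u. card {c \<in> ?A. u \<in> N c})"
  have "w u \<le> card {c \<in> ?A. u \<in> N c}" if "u \<in> verts G" for u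
  proof -
    have "C u \<subseteq> {c \<in> ?A. u \<in> N c}"
      using C sub that unfolding is_coloring_def all_colors_def by blast
    then have "card (C u) \<le> card {c \<in> ?A. u \<in> N c}"
      using finite_all_colors[OF assms(1,2)] by (intro card_mono) auto
    then show ?thesis
      using C that by (simp add: is_coloring_def)
  qed
  then have "x \<le> ?y"
    using bij_betwE[OF assms(3)] by (simp add: x weight_vec_def le_fun_def)
  moreover have "?y \<in> W_max G n v L"
    unfolding W_max_eq[OF assms(1,2)] using N by blast
  ultimately show thesis
    using that by blast
qed

text \<open>Discarding surplus colors at each vertex preserves both membership in the lists and
  disjointness along edges.\<close>

lemma W_set_downward_closed:
  assumes bij: "bij_betw v {1..n} (verts G)" and "y \<in> W_set G n v L" "x \<le> y"
  shows "x \<in> W_set G n v L"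
proof -
  obtain w C where y: "y = weight_vec n v w" and C: "is_coloring G L w C"
    using assms(2) unfolding W_set_def colorable_def by blast
  \<comment> \<open>The vector \<open>x\<close> is indexed by positions; the inverse of the
    enumeration turns it into a weight on vertices.\<close>
  define w' where "w' u = x (the_inv_into {1..n} v u)" for u
  have w'_v: "w' (v i) = x i" if "i \<in> {1..n}" for i
    using bij that by (simp add: w'_def bij_betw_def the_inv_into_f_f)
  have le: "x i \<le> weight_vec n v w i" for i
    using assms(3) y by (simp add: le_fun_def)
  have x: "x = weight_vec n v w'"
  proof
    fix i show "x i = weight_vec n v w' i"
      \<comment> \<open>Outside \<open>{1..n}\<close> the bound \<open>le\<close> forces
        \<open>x i = 0\<close>.\<close>
      using w'_v[of i] le[of i] by (auto simp: weight_vec_def)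
  qed
  have "\<exists>B. B \<subseteq> C u \<and> card B = w' u" if u: "u \<in> verts G" for u
  proof -
    obtain i where i: "i \<in> {1..n}" "u = v i"
      using bij u unfolding bij_betw_def by blast
    then have "w' u \<le> card (C u)"
      using le[of i] w'_v[of i] C u by (simp add: weight_vec_def is_coloring_def)
    then show ?thesis
      by (meson obtain_subset_with_card_n)
  qed
  then obtain B where B: "\<forall>u\<in>verts G. B u \<subseteq> C u \<and> card (B u) = w' u"
    by metis
  \<comment> \<open>\<open>B\<close> is unspecified outside \<open>verts G\<close>, while the
    disjointness condition of \<open>is_coloring\<close> ranges over all arcs; the default
    \<open>{}\<close> settles endpoints outside.\<close>
  define C' where "C' u = (if u \<in> verts G then B u else {})" for u
  have "is_coloring G L w' C'"
    using C B unfolding is_coloring_def C'_def by (simp split: if_splits) blast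
  then show ?thesis
    unfolding x W_set_def colorable_def by blast
qed

lemma vec_norm_mono: "x \<le> y \<Longrightarrow> vec_norm n x \<le> vec_norm n y"
  by (simp add: vec_norm_def le_fun_def sum_mono)

lemma vec_norm_diff: "x \<le> y \<Longrightarrow> vec_norm n (y - x) = vec_norm n y - vec_norm n x"
  by (simp add: vec_norm_def le_fun_def sum_subtractf_nat)

text \<open>Termwise inequalities whose sums agree are equalities; outside \<open>{1..n}\<close>
  both entries are 0.\<close>

lemma eq_if_le_and_vec_norm_le:
  assumes "x \<le> y" "y \<in> nat_vecs n" "vec_norm n y \<le> vec_norm n x"
  shows "x = y"
proof
  fix i
  have le: "x j \<le> y j" for j
    using assms(1) by (simp add: le_fun_def)
  have "sum x {1..n} = sum y {1..n}"
    using assms(3) vec_norm_mono[OF assms(1), of n] by (simp add: vec_norm_def)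
  then have "x i = y i" if "i \<in> {1..n}"
    using sum_mono_inv[of x "{1..n}" y i] le that by simp
  moreover have "x i = y i" if "i \<notin> {1..n}"
    using assms(2) le[of i] that by (simp add: nat_vecs_def)
  ultimately show "x i = y i" by blast
qed

theorem theorem6p1:
  fixes G :: "('a, 'b) pre_digraph"
    and n :: nat
    and v :: "nat \<Rightarrow> 'a"
    and L :: "'a \<Rightarrow> nat set"
    and w :: "'a \<Rightarrow> nat"
    and wstar :: "nat \<Rightarrow> nat"
  assumes "graph G"
    and "bij_betw v {1..n} (verts G)"
    and "list_of_graph G L"
    and "wstar \<in> nat_vecs n"
  shows "on_call_solution G n v L w wstar \<longleftrightarrow>
    wstar \<in> min_set (weight_vec n v w) (W_max G n v L) \<and>
    (\<forall>w' \<in> min_set (weight_vec n v w) (W_max G n v L). vec_norm n w' \<le> vec_norm n wstar)"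
proof -
  let ?w = "weight_vec n v w" and ?W = "W_set G n v L"
  let ?M = "min_set ?w (W_max G n v L)"
  have fin: "finite (verts G)"
    using assms(2) bij_betw_finite by blast
  have M_feasible: "z \<in> ?W \<and> z \<le> ?w" if z: "z \<in> ?M" for z
  proof -
    obtain y where y: "y \<in> W_max G n v L" "z = vec_min ?w y"
      using z by (auto simp: min_set_def)
    then have "y \<in> ?W" "z \<le> y" "z \<le> ?w"
      using W_max_subset_W_set[OF fin assms(3)] by (auto simp: vec_min_def le_fun_def)
    then show ?thesis
      using W_set_downward_closed[OF assms(2)] by blast
  qed
  \<comment> \<open>A feasible \<open>x\<close> lies below some \<open>y\<close> in
    \<open>W_max\<close> and below \<open>?w\<close>, hence below their minimum.\<close>
  have below_M: "\<exists>z\<in>?M. x \<le> z" if x: "x \<in> ?W" "x \<le> ?w" for x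
  proof -
    obtain y where "y \<in> W_max G n v L" "x \<le> y"
      using W_set_below_W_max[OF fin assms(3,2) x(1)] .
    then have "vec_min ?w y \<in> ?M" "x \<le> vec_min ?w y"
      using x(2) by (auto simp: min_set_def vec_min_def le_fun_def)
    then show ?thesis by blast
  qed
  have norm_le: "vec_norm n x \<le> vec_norm n ?w" if "x \<le> ?w" for x
    using that by (rule vec_norm_mono)
  \<comment> \<open>Below \<open>?w\<close> the norm of the difference is the difference of the
    norms, so minimizing the loss means maximizing the norm.\<close>
  have solution_iff: "on_call_solution G n v L w wstar \<longleftrightarrow>
      wstar \<in> ?W \<and> wstar \<le> ?w \<and> (\<forall>y\<in>?W. y \<le> ?w \<longrightarrow> vec_norm n y \<le> vec_norm n wstar)"
    unfolding on_call_solution_def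
    using norm_le by (auto simp: vec_norm_diff) (metis diff_le_mono2 le_diff_iff')+
  show ?thesis
  proof
    assume "on_call_solution G n v L w wstar"
    then have sol: "wstar \<in> ?W" "wstar \<le> ?w"
      and opt: "\<And>y. y \<in> ?W \<Longrightarrow> y \<le> ?w \<Longrightarrow> vec_norm n y \<le> vec_norm n wstar"
      unfolding solution_iff by blast+
    obtain z where z: "z \<in> ?M" "wstar \<le> z"
      using below_M[OF sol] by blast
    have "z \<in> nat_vecs n"
      using M_feasible[OF z(1)] by (auto simp: W_set_def nat_vecs_def weight_vec_def)
    \<comment> \<open>\<open>z\<close> is feasible, so optimality bounds its norm by that of
      \<open>wstar\<close>, although \<open>wstar \<le> z\<close>.\<close>
    then have "wstar = z"
      using eq_if_le_and_vec_norm_le[OF z(2)] opt M_feasible[OF z(1)] by blast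
    then show "wstar \<in> ?M \<and> (\<forall>w'\<in>?M. vec_norm n w' \<le> vec_norm n wstar)"
      using z(1) opt M_feasible by blast
  next
    assume R: "wstar \<in> ?M \<and> (\<forall>w'\<in>?M. vec_norm n w' \<le> vec_norm n wstar)"
    \<comment> \<open>A feasible competitor \<open>y\<close> lies below an element of
      \<open>?M\<close>, whose norm \<open>R\<close> bounds by that of \<open>wstar\<close>.\<close>
    have "vec_norm n y \<le> vec_norm n wstar" if "y \<in> ?W" "y \<le> ?w" for y
      using below_M[OF that] R vec_norm_mono le_trans by blast
    then show "on_call_solution G n v L w wstar"
      unfolding solution_iff using R M_feasible by blast
  qed
qed

end
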